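(* Let $A,B\in\mathbb{R}^{n\times n}$ and $b\in\mathbb{R}^n$ be such that the generalized absolute value equation $Ax-B|x|=b$ has a unique solution $x^{\ast}\in\mathbb{R}^n$. Let $A+B$ be symmetric positive definite, let $\tau=2\|B\|_{2}$, and let $\Omega=\omega I$ with $\omega>0$, where $I$ is the identity matrix. Let $\mu_{\min}$ be the smallest eigenvalue of $A+B$. If $\tau<\mu_{\min}$, then the maximum-based iteration method $$x^{k+1}=(A+B+\Omega)^{-1}\bigl(\Omega x^{k}+2B\max\{0,x^{k}\}+b\bigr),\quad k=0,1,2,\ldots,$$ is convergent, i.e., for every initial vector $x^{0}\in\mathbb{R}^n$ the sequence $\{x^k\}$ converges to $x^{\ast}$.
   Context: For $x\in\mathbb{R}^n$, $|x|$ denotes the entrywise absolute value and $\max\{0,x\}$ the entrywise maximum of $x$ and the zero vector. $\|\cdot\|_2$ denotes the matrix 2-norm (spectral norm). Neither $A$ nor $B$ individually is assumed symmetric or positive definite. *)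

theory Defs
  imports "HOL-Analysis.Analysis"
begin

definition sym_pos_def :: "real ^ 'n ^ 'n \<Rightarrow> bool" where
  "sym_pos_def M \<longleftrightarrow> transpose M = M \<and> (\<forall>x. x \<noteq> 0 \<longrightarrow> x \<bullet> (M *v x) > 0)"

definition real_eigenvalue :: "real ^ 'n ^ 'n \<Rightarrow> real \<Rightarrow> bool" where
  "real_eigenvalue M l \<longleftrightarrow> (\<exists>v. v \<noteq> 0 \<and> M *v v = l *\<^sub>R v)"

text \<open>
  Intended for symmetric matrices only: there every eigenvalue is real and a smallest one
  exists. In general the least element need not exist and the value is unspecified.
\<close>
definition min_eigenvalue :: "real ^ 'n ^ 'n \<Rightarrow> real" where
  "min_eigenvalue M = (LEAST l. real_eigenvalue M l)"

text \<open>The norm on \<^typ>\<open>real ^ 'n\<close> is Euclidean, so its operator norm is the spectral norm.\<close>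
definition spectral_norm :: "real ^ 'n ^ 'n \<Rightarrow> real" where
  "spectral_norm M = onorm ((*v) M)"

text \<open>
  On \<^typ>\<open>real ^ 'n\<close> the absolute value and the lattice supremum are entrywise,
  so \<^term>\<open>\<bar>x :: real ^ 'n\<bar>\<close> is the vector of absolute values and
  \<^term>\<open>sup 0 (x :: real ^ 'n)\<close> is the entrywise maximum of 0 and x.
\<close>
definition gave_solution ::
  "real ^ 'n ^ 'n \<Rightarrow> real ^ 'n ^ 'n \<Rightarrow> real ^ 'n \<Rightarrow> real ^ 'n \<Rightarrow> bool" where
  "gave_solution A B b x \<longleftrightarrow> A *v x - B *v \<bar>x\<bar> = b"

primrec max_iteration ::
  "real ^ 'n ^ 'n \<Rightarrow> real ^ 'n ^ 'n \<Rightarrow> real ^ 'n ^ 'n \<Rightarrow> real ^ 'n \<Rightarrow> real ^ 'n \<Rightarrow> nat \<Rightarrow> real ^ 'n"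
where
  "max_iteration A B Om b x0 0 = x0"
| "max_iteration A B Om b x0 (Suc k) =
     matrix_inv (A + B + Om) *v
       (Om *v max_iteration A B Om b x0 k
        + (2 *\<^sub>R B) *v sup 0 (max_iteration A B Om b x0 k) + b)"

end

theory Submission
  imports Defs
begin

text \<open>
  With \<open>M = A + B\<close>, the identity \<open>2 max{0, x} = x + |x|\<close> turns the equation into the fixed-point
  equation \<open>(M + \<Omega>) x = \<Omega> x + 2 B max{0, x} + b\<close>. The right-hand side is Lipschitz with constant
  \<open>\<omega> + \<tau>\<close>, and by the Rayleigh bound \<open>x \<bullet> M x \<ge> \<mu>min (x \<bullet> x)\<close> the inverse of \<open>M + \<Omega>\<close> has norm at
  most \<open>1 / (\<omega> + \<mu>min)\<close>, so the iteration contracts errors by the factor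
  \<open>(\<omega> + \<tau>) / (\<omega> + \<mu>min) < 1\<close>.
\<close>

lemma inner_symmetric_matrix_commute:
  fixes M :: "real ^ 'n ^ 'n"
  assumes "transpose M = M"
  shows "x \<bullet> (M *v y) = y \<bullet> (M *v x)"
  by (metis assms dot_lmul_matrix inner_commute transpose_matrix_vector)

text \<open>A nonzero \<open>w = N *v v\<close> would be a descent direction: along
  \<open>v - s *\<^sub>R w\<close> the quadratic form is \<open>s * (s * q - 2 * a)\<close> with
  \<open>a > 0\<close>, which is negative for small \<open>s > 0\<close>.\<close>

lemma symmetric_psd_isotropic_imp_kernel:
  fixes N :: "real ^ 'n ^ 'n"
  assumes sym: "transpose N = N"
    and nonneg: "\<And>x. 0 \<le> x \<bullet> (N *v x)"
    and v: "v \<bullet> (N *v v) = 0"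
  shows "N *v v = 0"
proof (rule ccontr)
  assume w: "N *v v \<noteq> 0"
  define w where "w = N *v v"
  define a where "a = w \<bullet> w"
  define q where "q = w \<bullet> (N *v w)"
  have a: "a > 0" using w by (simp add: a_def w_def)
  have q: "q \<ge> 0" unfolding q_def by (rule nonneg)
  \<comment> \<open>Any positive step with \<open>s * q < 2 * a\<close> would do; adding 1 keeps the
    denominator positive even if \<open>q = 0\<close>.\<close>
  define s where "s = a / (q + 1)"
  have s: "s > 0" using a q by (simp add: s_def)
  have "v \<bullet> (N *v w) = a"
    using inner_symmetric_matrix_commute[OF sym, of v w] by (simp add: a_def w_def)
  then have "(v - s *\<^sub>R w) \<bullet> (N *v (v - s *\<^sub>R w)) = s * (s * q - 2 * a)"
    using v by (simp add: matrix_vector_mult_diff_distrib matrix_vector_mult_scaleR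
        inner_diff_left inner_diff_right a_def q_def w_def[symmetric] algebra_simps)
  then have "0 \<le> s * q - 2 * a"
    using nonneg[of "v - s *\<^sub>R w"] s by (simp add: zero_le_mult_iff)
  moreover have "s * q \<le> a"
    using a q by (simp add: s_def field_simps)
  ultimately show False using a by simp
qed

text \<open>By compactness the quadratic form attains its minimum \<open>m\<close> on the unit
  sphere. This \<open>m\<close> is an eigenvalue and bounds every other one from below, so the
  \<open>LEAST\<close> in \<open>min_eigenvalue\<close> exists and equals \<open>m\<close>.\<close>

lemma min_eigenvalue_rayleigh:
  fixes M :: "real ^ 'n ^ 'n"
  assumes sym: "transpose M = M"
  shows "min_eigenvalue M * (x \<bullet> x) \<le> x \<bullet> (M *v x)"
proof -
  obtain e :: "real ^ 'n" where "norm e = 1" using vector_choose_size[of 1] by auto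
  then have "sphere (0 :: real ^ 'n) 1 \<noteq> {}" by auto
  moreover have "continuous_on (sphere 0 1) (\<lambda>x. x \<bullet> (M *v x))"
    by (intro continuous_intros linear_continuous_on matrix_vector_mul_bounded_linear)
  ultimately obtain v where v: "norm v = 1"
    and min: "\<And>y. norm y = 1 \<Longrightarrow> v \<bullet> (M *v v) \<le> y \<bullet> (M *v y)"
    using continuous_attains_inf[OF compact_sphere, of 0 1 "\<lambda>x. x \<bullet> (M *v x)"] by auto
  define m where "m = v \<bullet> (M *v v)"
  have rayleigh: "m * (y \<bullet> y) \<le> y \<bullet> (M *v y)" for y
  proof (cases "y = 0")
    case False
    have "m \<le> (y /\<^sub>R norm y) \<bullet> (M *v (y /\<^sub>R norm y))"
      unfolding m_def using False by (intro min) simp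
    also have "\<dots> = (y \<bullet> (M *v y)) / (y \<bullet> y)"
      by (simp add: matrix_vector_mult_scaleR dot_square_norm power2_eq_square divide_simps)
    finally show ?thesis using False by (simp add: pos_le_divide_eq)
  qed simp
  \<comment> \<open>The shifted matrix is positive semidefinite and its form vanishes at the
    minimizer \<open>v\<close>. Hence \<open>v\<close> lies in its kernel, that is,
    \<open>M *v v = m *\<^sub>R v\<close>.\<close>
  define N where "N = M - m *\<^sub>R mat 1"
  have N: "N *v y = M *v y - m *\<^sub>R y" for y
    by (simp add: N_def matrix_vector_mult_diff_rdistrib scaleR_matrix_vector_assoc[symmetric])
  have "N *v v = 0"
  proof (rule symmetric_psd_isotropic_imp_kernel)
    show "transpose N = N"
      using sym by (auto simp: N_def transpose_def mat_def vec_eq_iff)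
    show "0 \<le> y \<bullet> (N *v y)" for y
      using rayleigh[of y] by (simp add: N inner_diff_right)
    show "v \<bullet> (N *v v) = 0"
      using v by (simp add: N inner_diff_right m_def dot_square_norm)
  qed
  then have "real_eigenvalue M m"
    unfolding real_eigenvalue_def N using v by (intro exI[of _ v]) auto
  moreover have "m \<le> l" if "real_eigenvalue M l" for l
  proof -
    from that obtain u where u: "u \<noteq> 0" "M *v u = l *\<^sub>R u"
      by (auto simp: real_eigenvalue_def)
    then have "m * (u \<bullet> u) \<le> l * (u \<bullet> u)" using rayleigh[of u] by simp
    then show ?thesis using u by simp
  qed
  ultimately have "min_eigenvalue M = m"
    unfolding min_eigenvalue_def by (intro Least_equality)
  then show ?thesis using rayleigh by simp
qed

lemma norm_sup_zero_diff_le: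
  fixes x y :: "real ^ 'n"
  shows "norm (sup 0 x - sup 0 y) \<le> norm (x - y)"
  by (rule norm_le_componentwise_cart) (auto simp: sup_vec_def sup_real_def)

lemma norm_matrix_vector_le_spectral_norm:
  fixes M :: "real ^ 'n ^ 'n"
  shows "norm (M *v x) \<le> spectral_norm M * norm x"
  unfolding spectral_norm_def by (rule onorm) (rule matrix_vector_mul_bounded_linear)

lemma spectral_norm_nonneg: "0 \<le> spectral_norm M"
  unfolding spectral_norm_def by (rule onorm_pos_le) (rule matrix_vector_mul_bounded_linear)

text \<open>Cauchy-Schwarz bounds \<open>x \<bullet> (C *v x)\<close> from above; then one factor
  \<open>norm x\<close> cancels.\<close>

lemma coercive_matrix_norm_lower_bound:
  fixes C :: "real ^ 'n ^ 'n"
  assumes "\<And>x. c * (x \<bullet> x) \<le> x \<bullet> (C *v x)"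
  shows "c * norm x \<le> norm (C *v x)"
proof (cases "x = 0")
  case False
  have "(c * norm x) * norm x \<le> x \<bullet> (C *v x)"
    using assms[of x] by (simp add: dot_square_norm power2_eq_square mult.assoc)
  also have "\<dots> \<le> norm (C *v x) * norm x"
    by (metis norm_cauchy_schwarz mult.commute)
  finally show ?thesis using False by simp
qed simp

text \<open>The bound forces a trivial kernel, which makes a square matrix invertible.\<close>

lemma matrix_inv_right_of_norm_lower_bound:
  fixes C :: "real ^ 'n ^ 'n"
  assumes "c > 0" and "\<And>x. c * norm x \<le> norm (C *v x)"
  shows "C *v (matrix_inv C *v y) = y"
proof -
  have "x = 0" if "C *v x = 0" for x
    using assms(1) assms(2)[of x] that by (simp add: mult_le_0_iff)
  then have "invertible C"
    using invertible_left_inverse matrix_left_invertible_ker by blast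
  \<comment> \<open>\<open>matrix_inv\<close> is defined by Hilbert choice, so its property follows
    from the existence of some inverse.\<close>
  then have "C ** matrix_inv C = mat 1"
    unfolding invertible_def matrix_inv_def by (rule someI2_ex) blast
  then show ?thesis
    by (simp add: matrix_vector_mul_assoc)
qed

text \<open>Adding \<open>B *v x\<close> to both sides of the equation turns
  \<open>B *v \<bar>x\<bar>\<close> into \<open>2 *\<^sub>R B\<close> applied to the positive
  part.\<close>

lemma gave_solution_iff_max:
  fixes A B :: "real ^ 'n ^ 'n"
  shows "gave_solution A B b x \<longleftrightarrow> (A + B) *v x = (2 *\<^sub>R B) *v sup 0 x + b"
proof -
  have "2 *\<^sub>R sup 0 x = x + \<bar>x\<bar>"
    by (auto simp: vec_eq_iff sup_vec_def sup_real_def abs_vec_def)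
  then have "(2 *\<^sub>R B) *v sup 0 x = B *v x + B *v \<bar>x\<bar>"
    by (metis matrix_vector_mult_scaleR scaleR_matrix_vector_assoc matrix_vector_right_distrib)
  then show ?thesis
    by (auto simp: gave_solution_def matrix_vector_mult_add_rdistrib algebra_simps)
qed

lemma LIMSEQ_of_norm_contraction:
  fixes f :: "nat \<Rightarrow> 'a::real_normed_vector"
  assumes "0 \<le> c" "c < 1"
    and step: "\<And>k. norm (f (Suc k) - l) \<le> c * norm (f k - l)"
  shows "f \<longlonglongrightarrow> l"
proof -
  have bound: "norm (f k - l) \<le> c ^ k * norm (f 0 - l)" for k
  proof (induction k)
    case (Suc k)
    then show ?case
      using step[of k] mult_left_mono[OF Suc \<open>0 \<le> c\<close>] by (simp add: mult.assoc)
  qed simp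
  have "(\<lambda>k. c ^ k * norm (f 0 - l)) \<longlonglongrightarrow> 0"
    using assms by (intro tendsto_mult_left_zero LIMSEQ_power_zero) simp
  then have "(\<lambda>k. f k - l) \<longlonglongrightarrow> 0"
    by (rule Lim_null_comparison[rotated]) (simp add: bound)
  then show ?thesis by (simp add: LIM_zero_iff)
qed

theorem theorem2p3:
  fixes A B \<Omega> :: "real ^ 'n ^ 'n"
    and b xstar :: "real ^ 'n"
    and \<tau> \<omega> \<mu>min :: real
  assumes sol: "gave_solution A B b xstar"
    and uniq: "\<And>y. gave_solution A B b y \<Longrightarrow> y = xstar"
    and spd: "sym_pos_def (A + B)"
    and tau: "\<tau> = 2 * spectral_norm B"
    and Omega: "\<Omega> = \<omega> *\<^sub>R mat 1"
    and omega_pos: "\<omega> > 0"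
    and mu: "\<mu>min = min_eigenvalue (A + B)"
    and less: "\<tau> < \<mu>min"
  shows "\<forall>x0. max_iteration A B \<Omega> b x0 \<longlonglongrightarrow> xstar"
proof
  fix x0
  define C where "C = A + B + \<Omega>"
  define X where "X = max_iteration A B \<Omega> b x0"
  have tau0: "0 \<le> \<tau>" by (simp add: tau spectral_norm_nonneg)
  have Omega_mult: "\<Omega> *v x = \<omega> *\<^sub>R x" for x
    by (simp add: Omega scaleR_matrix_vector_assoc[symmetric])
  have "(\<omega> + \<mu>min) * (x \<bullet> x) \<le> x \<bullet> (C *v x)" for x
    using min_eigenvalue_rayleigh[of "A + B" x] spd
    by (simp add: C_def sym_pos_def_def mu matrix_vector_mult_add_rdistrib[of "A + B"] Omega_mult
        inner_add_right ring_distribs)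
  then have lower: "(\<omega> + \<mu>min) * norm x \<le> norm (C *v x)" for x
    by (rule coercive_matrix_norm_lower_bound)
  have pos: "\<omega> + \<mu>min > 0" using omega_pos tau0 less by simp
  have fixed: "C *v xstar = \<Omega> *v xstar + (2 *\<^sub>R B) *v sup 0 xstar + b"
    using sol by (simp add: gave_solution_iff_max C_def matrix_vector_mult_add_rdistrib[of "A + B"])
  \<comment> \<open>Applying \<open>C\<close> clears the inverse from the recursion, so
    \<open>lower\<close> can take the place of a norm estimate for
    \<open>matrix_inv C\<close>.\<close>
  have iter: "C *v X (Suc k) = \<Omega> *v X k + (2 *\<^sub>R B) *v sup 0 (X k) + b" for k
    using matrix_inv_right_of_norm_lower_bound[OF pos lower] by (simp add: X_def C_def)
  show "max_iteration A B \<Omega> b x0 \<longlonglongrightarrow> xstar"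
    unfolding X_def[symmetric]
  proof (rule LIMSEQ_of_norm_contraction)
    show "0 \<le> (\<omega> + \<tau>) / (\<omega> + \<mu>min)" "(\<omega> + \<tau>) / (\<omega> + \<mu>min) < 1"
      using omega_pos tau0 less pos by auto
    fix k
    \<comment> \<open>Subtracting \<open>fixed\<close> from \<open>iter\<close> cancels
      \<open>b\<close> and leaves a relation between successive errors.\<close>
    have "C *v (X (Suc k) - xstar)
        = \<omega> *\<^sub>R (X k - xstar) + 2 *\<^sub>R (B *v (sup 0 (X k) - sup 0 xstar))"
      by (simp add: matrix_vector_mult_diff_distrib iter fixed Omega_mult
          scaleR_matrix_vector_assoc[symmetric] algebra_simps)
    then have "norm (C *v (X (Suc k) - xstar))
        \<le> \<omega> * norm (X k - xstar) + 2 * norm (B *v (sup 0 (X k) - sup 0 xstar))"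
      using norm_triangle_ineq[of "\<omega> *\<^sub>R (X k - xstar)"
          "2 *\<^sub>R (B *v (sup 0 (X k) - sup 0 xstar))"] omega_pos by simp
    also have "\<dots> \<le> \<omega> * norm (X k - xstar)
        + 2 * (spectral_norm B * norm (sup 0 (X k) - sup 0 xstar))"
      using norm_matrix_vector_le_spectral_norm by simp
    also have "\<dots> \<le> \<omega> * norm (X k - xstar) + 2 * (spectral_norm B * norm (X k - xstar))"
      using mult_left_mono[OF norm_sup_zero_diff_le spectral_norm_nonneg] by simp
    finally have "norm (C *v (X (Suc k) - xstar)) \<le> (\<omega> + \<tau>) * norm (X k - xstar)"
      by (simp add: tau ring_distribs)
    \<comment> \<open>Here \<open>lower\<close> is applied to the new error and the result is
      divided by \<open>\<omega> + \<mu>min\<close>.\<close>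
    then show "norm (X (Suc k) - xstar) \<le> (\<omega> + \<tau>) / (\<omega> + \<mu>min) * norm (X k - xstar)"
      using order_trans[OF lower] pos by (simp add: field_simps)
  qed
qed

end
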